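(* Suppose $(\mathfrak X,\mathcal V^* )$, with surjective summary maps $\{\sigma_t\}_{t=0}^{T+1}$, factorizes a compatible utility system $\mathbf U$ for the grand preference $\mathcal P$, and that the feasibility correspondences satisfy Markov feasibility and DP regularity (defined in the context). Let $J_t^*(x_t)=\sup_{\pi\in\Pi}U_t^{*\pi}(x_t)$, $t\in[T]$, and let $\bar\pi\in\Pi$ be any Bellman selector, i.e. $$\bar\pi_T(x_T)\in\arg\max_{c\in\mathcal A_T(x_T)}U_{T+1}^*(\Gamma_T(x_T,c,\star)),\quad\forall x_T\in\mathcal X_T,$$ $$\bar\pi_t(x_t)\in\arg\max_{c\in\mathcal A_t(x_t)}W_t^*\bigl(x_t,c,M_t^*(x_t,\tilde j^*_{t+1}(x_t,c))\bigr),\quad\forall x_t\in\mathcal X_t,\ t\in[T-1],$$ where $[\tilde j^*_{t+1}(x_t,c)](s)=J^*_{t+1}(\Gamma_t(x_t,c,s))$ for $s\in\mathcal S$. Let $\bar\varphi$ be its induced full-history policy, $\bar\varphi_t(h_t)=\bar\pi_t(\sigma_t(h_t))$. Then, for every feasible history-dependent policy $\varphi\in\Phi$, $$U_t^{\varphi}(h_t)\le J_t^*(\sigma_t(h_t))=U_t^{\bar\varphi}(h_t),\quad\forall h_t\in\mathcal H_t,\ t\in[T].$$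
   Context: **Primitives.** For an integer $n\ge 0$, $[n]=\{0,1,\dots,n\}$. $T\ge 1$ is an integer horizon. $\mathcal S$ is a finite nonempty set (discrete topology); $\mathcal S_0=\{\bar s_0\}$ is a singleton, $\mathcal S_t=\mathcal S$ for $1\le t\le T$, $\mathcal S_{T+1}=\{\star\}$. $\mathcal C=[0,\bar c]\subset\mathbb R_{\ge 0}$ is a compact interval. Histories: $\mathcal H_0=\{\bar s_0\}$, $\mathcal H_t=\mathcal H_{t-1}\times\mathcal C\times\mathcal S_t$ for $1\le t\le T$, $\mathcal H_{T+1}=\mathcal H_T\times\mathcal C$, with product topologies (compact metrizable). Extension maps $\iota_t:\mathcal H_t\times\mathcal C\times\mathcal S_{t+1}\to\mathcal H_{t+1}$: $\iota_t(h_t,c,s)=(h_t,c,s)$ for $t\in[T-1]$, $\iota_T(h_T,c,\star)=(h_T,c)$. Physical-state projections $\sigma^s_t:\mathcal H_t\to\mathcal S_t$: $\sigma_t^s(h_t)$ is the last state $s_t$ of $h_t$ for $t\in[T]$, and $\sigma^s_{T+1}\equiv\star$. Plans: $\mathcal F_{T+1}=\{\emptyset\}$ and $\mathcal F_t=\mathcal C\times(\mathcal F_{t+1})^{\mathcal S}$ for $t\in[T]$ (product topology); $\mathcal F_T$ is identified with $\mathcal C$. For $t\in[T-1]$ a plan is written $f=(c,f_+)$ with $c\in\mathcal C$, $f_+:\mathcal S\to\mathcal F_{t+1}$. $\mathcal L=\mathbb R^{\mathcal S}$ with sup norm and pointwise order; $\mathbf v\in\mathcal L$ is the constant vector with value $v$.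 **Preferences.** A grand preference is $\mathcal P=(\{\succeq_{(t)}\}_{t=0}^T,V_{T+1})$ with $\succeq_{(t)}$ a binary relation on $\mathcal H_t\times\mathcal F_t$ and $V_{T+1}:\mathcal H_{T+1}\to\mathbb R$ continuous. A utility system is $\mathbf U=\{U_t\}_{t=0}^{T+1}$ with $U_t:\mathcal H_t\times\mathcal F_t\to\mathbb R$ ($t\in[T]$) and $U_{T+1}:\mathcal H_{T+1}\to\mathbb R$ continuous. It is compatible with $\mathcal P$ if $U_{T+1}=V_{T+1}$; $U_T(h_T,c)=U_{T+1}(\iota_T(h_T,c,\star))$; and for all $t\in[T]$, $U_t(h_t,f)\ge U_t(h_t',g)\iff(h_t,f)\succeq_{(t)}(h_t',g)$. **PA-state systems.** A PA-state system is $\mathfrak X=(\{\mathcal X_t\}_{t=0}^{T+1},\{\varsigma_t\}_{t=0}^{T+1},\{\Gamma_t\}_{t=0}^{T})$ with $\mathcal X_t$ nonempty compact metrizable, $\varsigma_t:\mathcal X_t\to\mathcal S_t$ continuous, and $\Gamma_t:\mathcal X_t\times\mathcal C\times\mathcal S_{t+1}\to\mathcal X_{t+1}$ continuous with $\varsigma_{t+1}(\Gamma_t(x,c,s'))=s'$. A PA recursive structure on $\mathfrak X$ is $\mathcal V^*=(\{W_t^*\}_{t=0}^{T-1},\{M_t^*\}_{t=0}^{T-1},V_{T+1}^* )$ where $W_t^*:\mathcal X_t\times\mathcal C\times\mathbb R\to\mathbb R$ is jointly continuous and nondecreasing in its last argument; $M_t^*:\mathcal X_t\times\mathcal L\to\mathbb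 R$ is jointly continuous, monotone in $\tilde u\in\mathcal L$, and $M_t^*(x,\mathbf v)=v$ for all $x$, $v\in\mathbb R$; $V_{T+1}^*:\mathcal X_{T+1}\to\mathbb R$ is continuous. $(\mathfrak X,\mathcal V^* )$ generates $\{U_t^*\}$: $U_{T+1}^*=V_{T+1}^*$, $U_T^*(x_T,c)=U_{T+1}^*(\Gamma_T(x_T,c,\star))$, and for $t\in[T-1]$, $f=(c,f_+)$, $U_t^*(x_t,f)=W_t^*(x_t,c,M_t^*(x_t,\tilde u^*_{t+1}(x_t,f)))$ with $[\tilde u^*_{t+1}(x_t,f)](s)=U_{t+1}^*(\Gamma_t(x_t,c,s),f_+(s))$. **Factorization.** $(\mathfrak X,\mathcal V^* )$ with continuous summary maps $\sigma_t:\mathcal H_t\to\mathcal X_t$ factorizes $\mathbf U$ if $\varsigma_t\circ\sigma_t=\sigma_t^s$ ($t\in[T+1]$), $U_{T+1}=U_{T+1}^*\circ\sigma_{T+1}$, $U_t(h_t,f)=U_t^*(\sigma_t(h_t),f)$ for all $h_t,f$, $t\in[T]$, and $\sigma_{t+1}(\iota_t(h_t,c,s))=\Gamma_t(\sigma_t(h_t),c,s)$ for all $h_t,c,s\in\mathcal S_{t+1}$, $t\in[T]$. **Feasibility and policies.** For $t\in[T]$, $\mathcal A_t:\mathcal H_t\rightrightarrows\mathcal C$ is the correspondence of feasible consumption levels. $\Phi$ is the set of history-dependent policies $\varphi=(\varphi_t)_{t=0}^T$, arbitrary functions $\varphi_t:\mathcal H_t\to\mathcal C$ with $\varphi_t(h_t)\in\mathcal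 A_t(h_t)$. The plan induced by $\varphi$ from $h_t$ is $f_T^\varphi[h_T]=\varphi_T(h_T)$ and, for $t\in[T-1]$, $f_t^\varphi[h_t]=(c,f_+)$ with $c=\varphi_t(h_t)$ and $f_+(s)=f_{t+1}^\varphi[\iota_t(h_t,c,s)]$; $U_t^\varphi(h_t)=U_t(h_t,f_t^\varphi[h_t])$. Markov feasibility: if $\sigma_t(h_t)=\sigma_t(h_t')$ then $\mathcal A_t(h_t)=\mathcal A_t(h_t')$; one then writes $\mathcal A_t(x_t)=\mathcal A_t(h_t)$ for any $h_t\in\sigma_t^{-1}(x_t)$. DP regularity: for all $t\in[T]$, $\mathcal A_t:\mathcal X_t\rightrightarrows\mathcal C$ is continuous (upper and lower hemicontinuous) with nonempty compact values. $\Pi$ is the set of all PA Markov policies $\pi=\{\pi_t\}_{t=0}^T$, i.e. arbitrary functions $\pi_t:\mathcal X_t\to\mathcal C$ with $\pi_t(x_t)\in\mathcal A_t(x_t)$. Policy utilities: $U_{T+1}^{*\pi}=U_{T+1}^*$, $U_T^{*\pi}(x_T)=U_{T+1}^{*\pi}(\Gamma_T(x_T,\pi_T(x_T),\star))$, and for $t\in[T-1]$, $U_t^{*\pi}(x_t)=W_t^*(x_t,\pi_t(x_t),M_t^*(x_t,\tilde u_{t+1}^{*\pi}(x_t,\pi_t(x_t))))$ with $[\tilde u_{t+1}^{*\pi}(x_t,c)](s)=U_{t+1}^{*\pi}(\Gamma_t(x_t,c,s))$ for $s\in\mathcal S$. *)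

theory Defs
  imports "HOL-Analysis.Analysis"
begin

section \<open>Primitives\<close>

text \<open>All time-indexed spaces are families over \<^typ>\<open>nat\<close>, of which only the members with index
  at most \<open>T + 1\<close> (or \<open>T\<close>, or \<open>T - 1\<close>) matter. The labels \<open>s\<^sub>0\<close> (field \<open>init_state\<close>) and
  \<open>\<star>\<close> (field \<open>term_state\<close>) are arbitrary; they may or may not belong to \<open>S\<close> (field \<open>states\<close>).\<close>

record 's env =
  horizon :: nat
  states :: "'s set"
  init_state :: 's
  term_state :: 's
  cmax :: real

definition primitives :: "'s env \<Rightarrow> bool" where
  "primitives E \<longleftrightarrow> 1 \<le> horizon E \<and> finite (states E) \<and> states E \<noteq> {} \<and> 0 \<le> cmax E"

definition state_set :: "'s env \<Rightarrow> nat \<Rightarrow> 's set" where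
  "state_set E t =
     (if t = 0 then {init_state E} else if t \<le> horizon E then states E else {term_state E})"

definition cons_set :: "'s env \<Rightarrow> real set" where
  "cons_set E = {0..cmax E}"

definition cons_top :: "'s env \<Rightarrow> real topology" where
  "cons_top E = top_of_set (cons_set E)"

text \<open>The space \<open>L = \<real>\<^sup>S\<close>: extensional functions on \<open>S\<close>. For finite \<open>S\<close> the metric
  \<^term>\<open>funspace S euclidean_metric\<close> is that of the sup norm on all of \<open>L\<close>.\<close>

definition vec_set :: "'s env \<Rightarrow> ('s \<Rightarrow> real) set" where
  "vec_set E = states E \<rightarrow>\<^sub>E UNIV"

definition vec_top :: "'s env \<Rightarrow> ('s \<Rightarrow> real) topology" where
  "vec_top E = mtopology_of (funspace (states E) euclidean_metric)"

lemma topspace_cons_top [simp]: "topspace (cons_top E) = cons_set E"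
  by (simp add: cons_top_def)

lemma topspace_vec_top:
  assumes "primitives E"
  shows "topspace (vec_top E) = vec_set E"
proof -
  have "finite (states E)"
    using assms by (simp add: primitives_def)
  then show ?thesis
    by (auto simp: vec_top_def vec_set_def Met_TC.fspace_def PiE_def finite_imp_bounded)
qed

section \<open>Histories\<close>

text \<open>\<open>HEnd\<close> builds the elements of \<open>H\<^sub>T\<^sub>+\<^sub>1 = H\<^sub>T \<times> C\<close>.\<close>

datatype 's hist = HInit 's | HStep "'s hist" real 's | HEnd "'s hist" real

fun hist_set :: "'s env \<Rightarrow> nat \<Rightarrow> 's hist set" where
  "hist_set E 0 = {HInit (init_state E)}"
| "hist_set E (Suc t) =
     (if t < horizon E
      then {HStep h c s | h c s. h \<in> hist_set E t \<and> c \<in> cons_set E \<and> s \<in> state_set E (Suc t)}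
      else {HEnd h c | h c. h \<in> hist_set E t \<and> c \<in> cons_set E})"

fun step_parts :: "'s hist \<Rightarrow> 's hist \<times> real \<times> 's" where
  "step_parts (HStep h c s) = (h, c, s)"
| "step_parts _ = undefined"

fun end_parts :: "'s hist \<Rightarrow> 's hist \<times> real" where
  "end_parts (HEnd h c) = (h, c)"
| "end_parts _ = undefined"

text \<open>The product topologies, transported along the bijections \<open>step_parts\<close> and \<open>end_parts\<close>.\<close>

fun hist_top :: "'s env \<Rightarrow> nat \<Rightarrow> 's hist topology" where
  "hist_top E 0 = discrete_topology (hist_set E 0)"
| "hist_top E (Suc t) =
     (if t < horizon E
      then pullback_topology (hist_set E (Suc t)) step_parts
             (prod_topology (hist_top E t)
               (prod_topology (cons_top E) (discrete_topology (state_set E (Suc t)))))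
      else pullback_topology (hist_set E (Suc t)) end_parts
             (prod_topology (hist_top E t) (cons_top E)))"

lemma topspace_hist_top: "topspace (hist_top E t) = hist_set E t"
  by (induction t) (auto simp: topspace_pullback_topology)

definition hist_extend :: "'s env \<Rightarrow> nat \<Rightarrow> 's hist \<Rightarrow> real \<Rightarrow> 's \<Rightarrow> 's hist" where
  "hist_extend E t h c s = (if t < horizon E then HStep h c s else HEnd h c)"

fun last_state :: "'s env \<Rightarrow> 's hist \<Rightarrow> 's" where
  "last_state E (HInit s) = s"
| "last_state E (HStep h c s) = s"
| "last_state E (HEnd h c) = term_state E"

section \<open>Plans\<close>

datatype 's plan = PEnd | Plan (cons_now: real) (cont_plan: "'s \<Rightarrow> 's plan")

function plan_set :: "'s env \<Rightarrow> nat \<Rightarrow> 's plan set" where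
  "plan_set E t =
     (if t \<le> horizon E
      then {Plan c g | c g. c \<in> cons_set E \<and> g \<in> states E \<rightarrow>\<^sub>E plan_set E (Suc t)}
      else {PEnd})"
  by pat_completeness auto
termination by (relation "Wellfounded.measure (\<lambda>(E, t). Suc (horizon E) - t)") auto

declare plan_set.simps [simp del]

function plan_top :: "'s env \<Rightarrow> nat \<Rightarrow> 's plan topology" where
  "plan_top E t =
     (if t \<le> horizon E
      then pullback_topology (plan_set E t) (\<lambda>f. (cons_now f, cont_plan f))
             (prod_topology (cons_top E)
               (product_topology (\<lambda>_. plan_top E (Suc t)) (states E)))
      else discrete_topology {PEnd})"
  by pat_completeness auto
termination by (relation "Wellfounded.measure (\<lambda>(E, t). Suc (horizon E) - t)") auto

declare plan_top.simps [simp del]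

lemma topspace_plan_top: "topspace (plan_top E t) = plan_set E t"
proof (induction E t rule: plan_top.induct)
  case (1 E t)
  then show ?case
    by (subst plan_top.simps, subst (2) plan_set.simps)
      (auto simp: topspace_pullback_topology plan_set.simps [of E t] PiE_def Pi_def)
qed

text \<open>The identification of \<open>C\<close> with \<open>F\<^sub>T = C \<times> {\<emptyset>}\<^sup>S\<close>.\<close>

definition last_plan :: "'s env \<Rightarrow> real \<Rightarrow> 's plan" where
  "last_plan E c = Plan c (\<lambda>s\<in>states E. PEnd)"

lemma plan_set_horizon: "plan_set E (horizon E) = last_plan E ` cons_set E"
proof -
  have "(states E \<rightarrow>\<^sub>E {PEnd}) = {\<lambda>s\<in>states E. PEnd}"
    by (auto simp: PiE_iff fun_eq_iff extensional_def)
  then show ?thesis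
    by (auto simp: plan_set.simps [of E "horizon E"] plan_set.simps [of E "Suc (horizon E)"]
        last_plan_def)
qed

section \<open>Preferences and utility systems\<close>

record 's grand_pref =
  pref :: "nat \<Rightarrow> ('s hist \<times> 's plan) rel"
  pref_end :: "'s hist \<Rightarrow> real"

definition grand_preference :: "'s env \<Rightarrow> 's grand_pref \<Rightarrow> bool" where
  "grand_preference E P \<longleftrightarrow>
     (\<forall>t\<le>horizon E. pref P t \<subseteq> (hist_set E t \<times> plan_set E t) \<times> (hist_set E t \<times> plan_set E t)) \<and>
     continuous_map (hist_top E (horizon E + 1)) euclideanreal (pref_end P)"

record 's util_sys =
  util :: "nat \<Rightarrow> 's hist \<Rightarrow> 's plan \<Rightarrow> real"
  util_end :: "'s hist \<Rightarrow> real"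

definition utility_system :: "'s env \<Rightarrow> 's util_sys \<Rightarrow> bool" where
  "utility_system E U \<longleftrightarrow>
     (\<forall>t\<le>horizon E. continuous_map (prod_topology (hist_top E t) (plan_top E t)) euclideanreal
        (\<lambda>(h, f). util U t h f)) \<and>
     continuous_map (hist_top E (horizon E + 1)) euclideanreal (util_end U)"

definition compatible :: "'s env \<Rightarrow> 's grand_pref \<Rightarrow> 's util_sys \<Rightarrow> bool" where
  "compatible E P U \<longleftrightarrow>
     (\<forall>h\<in>hist_set E (horizon E + 1). util_end U h = pref_end P h) \<and>
     (\<forall>h\<in>hist_set E (horizon E). \<forall>c\<in>cons_set E.
        util U (horizon E) h (last_plan E c)
          = util_end U (hist_extend E (horizon E) h c (term_state E))) \<and>
     (\<forall>t\<le>horizon E. \<forall>h\<in>hist_set E t. \<forall>h'\<in>hist_set E t. \<forall>f\<in>plan_set E t. \<forall>g\<in>plan_set E t.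
        util U t h f \<ge> util U t h' g \<longleftrightarrow> ((h, f), (h', g)) \<in> pref P t)"

section \<open>PA-state systems and PA recursive structures\<close>

text \<open>The spaces \<open>X\<^sub>t\<close> share one carrier type; this is no restriction, since any family of spaces
  embeds in its disjoint union.\<close>

record ('s, 'x) pa_sys =
  pa_space :: "nat \<Rightarrow> 'x topology"
  pa_label :: "nat \<Rightarrow> 'x \<Rightarrow> 's"
  pa_trans :: "nat \<Rightarrow> 'x \<Rightarrow> real \<Rightarrow> 's \<Rightarrow> 'x"

definition pa_state_system :: "'s env \<Rightarrow> ('s, 'x) pa_sys \<Rightarrow> bool" where
  "pa_state_system E X \<longleftrightarrow>
     (\<forall>t\<le>horizon E + 1.
        topspace (pa_space X t) \<noteq> {} \<and> compact_space (pa_space X t) \<and>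
        metrizable_space (pa_space X t) \<and>
        continuous_map (pa_space X t) (discrete_topology (state_set E t)) (pa_label X t)) \<and>
     (\<forall>t\<le>horizon E.
        continuous_map
          (prod_topology (pa_space X t)
            (prod_topology (cons_top E) (discrete_topology (state_set E (t + 1)))))
          (pa_space X (t + 1)) (\<lambda>(x, c, s). pa_trans X t x c s) \<and>
        (\<forall>x\<in>topspace (pa_space X t). \<forall>c\<in>cons_set E. \<forall>s'\<in>state_set E (t + 1).
           pa_label X (t + 1) (pa_trans X t x c s') = s'))"

record ('s, 'x) pa_rec =
  aggr :: "nat \<Rightarrow> 'x \<Rightarrow> real \<Rightarrow> real \<Rightarrow> real"
  cert :: "nat \<Rightarrow> 'x \<Rightarrow> ('s \<Rightarrow> real) \<Rightarrow> real"
  end_val :: "'x \<Rightarrow> real"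

definition pa_recursive_structure ::
    "'s env \<Rightarrow> ('s, 'x) pa_sys \<Rightarrow> ('s, 'x) pa_rec \<Rightarrow> bool" where
  "pa_recursive_structure E X V \<longleftrightarrow>
     (\<forall>t<horizon E.
        continuous_map (prod_topology (pa_space X t) (prod_topology (cons_top E) euclideanreal))
          euclideanreal (\<lambda>(x, c, v). aggr V t x c v) \<and>
        (\<forall>x\<in>topspace (pa_space X t). \<forall>c\<in>cons_set E. mono (aggr V t x c)) \<and>
        continuous_map (prod_topology (pa_space X t) (vec_top E)) euclideanreal
          (\<lambda>(x, u). cert V t x u) \<and>
        (\<forall>x\<in>topspace (pa_space X t). \<forall>u\<in>vec_set E. \<forall>w\<in>vec_set E.
           (\<forall>s\<in>states E. u s \<le> w s) \<longrightarrow> cert V t x u \<le> cert V t x w) \<and>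
        (\<forall>x\<in>topspace (pa_space X t). \<forall>v. cert V t x (\<lambda>s\<in>states E. v) = v)) \<and>
     continuous_map (pa_space X (horizon E + 1)) euclideanreal (end_val V)"

text \<open>The generated utilities \<open>U\<^sup>*\<^sub>t\<close> for \<open>t \<le> T\<close>; \<open>U\<^sup>*\<^sub>T\<^sub>+\<^sub>1\<close> is \<^term>\<open>end_val V\<close>.\<close>

function pa_util ::
    "'s env \<Rightarrow> ('s, 'x) pa_sys \<Rightarrow> ('s, 'x) pa_rec \<Rightarrow> nat \<Rightarrow> 'x \<Rightarrow> 's plan \<Rightarrow> real" where
  "pa_util E X V t x f =
     (if t < horizon E
      then aggr V t x (cons_now f)
             (cert V t x
               (\<lambda>s\<in>states E.
                  pa_util E X V (Suc t) (pa_trans X t x (cons_now f) s) (cont_plan f s)))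
      else end_val V (pa_trans X t x (cons_now f) (term_state E)))"
  by pat_completeness auto
termination by (relation "Wellfounded.measure (\<lambda>(E, X, V, t, x, f). horizon E - t)") auto

declare pa_util.simps [simp del]

definition factorizes ::
    "'s env \<Rightarrow> ('s, 'x) pa_sys \<Rightarrow> ('s, 'x) pa_rec \<Rightarrow> (nat \<Rightarrow> 's hist \<Rightarrow> 'x) \<Rightarrow> 's util_sys \<Rightarrow> bool"
  where
  "factorizes E X V \<sigma> U \<longleftrightarrow>
     (\<forall>t\<le>horizon E + 1.
        continuous_map (hist_top E t) (pa_space X t) (\<sigma> t) \<and>
        (\<forall>h\<in>hist_set E t. pa_label X t (\<sigma> t h) = last_state E h)) \<and>
     (\<forall>h\<in>hist_set E (horizon E + 1). util_end U h = end_val V (\<sigma> (horizon E + 1) h)) \<and>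
     (\<forall>t\<le>horizon E. \<forall>h\<in>hist_set E t. \<forall>f\<in>plan_set E t.
        util U t h f = pa_util E X V t (\<sigma> t h) f) \<and>
     (\<forall>t\<le>horizon E. \<forall>h\<in>hist_set E t. \<forall>c\<in>cons_set E. \<forall>s\<in>state_set E (t + 1).
        \<sigma> (t + 1) (hist_extend E t h c s) = pa_trans X t (\<sigma> t h) c s)"

section \<open>Feasibility and policies\<close>

definition feasibility_correspondence :: "'s env \<Rightarrow> (nat \<Rightarrow> 's hist \<Rightarrow> real set) \<Rightarrow> bool" where
  "feasibility_correspondence E A \<longleftrightarrow> (\<forall>t\<le>horizon E. \<forall>h\<in>hist_set E t. A t h \<subseteq> cons_set E)"

definition history_policies ::
    "'s env \<Rightarrow> (nat \<Rightarrow> 's hist \<Rightarrow> real set) \<Rightarrow> (nat \<Rightarrow> 's hist \<Rightarrow> real) set" where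
  "history_policies E A = {\<phi>. \<forall>t\<le>horizon E. \<forall>h\<in>hist_set E t. \<phi> t h \<in> A t h}"

function induced_plan :: "'s env \<Rightarrow> (nat \<Rightarrow> 's hist \<Rightarrow> real) \<Rightarrow> nat \<Rightarrow> 's hist \<Rightarrow> 's plan" where
  "induced_plan E \<phi> t h =
     (if t < horizon E
      then Plan (\<phi> t h)
             (\<lambda>s\<in>states E. induced_plan E \<phi> (Suc t) (hist_extend E t h (\<phi> t h) s))
      else last_plan E (\<phi> t h))"
  by pat_completeness auto
termination by (relation "Wellfounded.measure (\<lambda>(E, \<phi>, t, h). horizon E - t)") auto

declare induced_plan.simps [simp del]

definition history_policy_util ::
    "'s env \<Rightarrow> 's util_sys \<Rightarrow> (nat \<Rightarrow> 's hist \<Rightarrow> real) \<Rightarrow> nat \<Rightarrow> 's hist \<Rightarrow> real" where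
  "history_policy_util E U \<phi> t h = util U t h (induced_plan E \<phi> t h)"

definition Markov_feasible ::
    "'s env \<Rightarrow> (nat \<Rightarrow> 's hist \<Rightarrow> 'x) \<Rightarrow> (nat \<Rightarrow> 's hist \<Rightarrow> real set) \<Rightarrow> bool" where
  "Markov_feasible E \<sigma> A \<longleftrightarrow>
     (\<forall>t\<le>horizon E. \<forall>h\<in>hist_set E t. \<forall>h'\<in>hist_set E t. \<sigma> t h = \<sigma> t h' \<longrightarrow> A t h = A t h')"

text \<open>\<open>A\<^sub>t(x) = A\<^sub>t(h)\<close> for any \<open>h \<in> \<sigma>\<^sub>t\<^sup>-\<^sup>1(x)\<close>; meaningful only for surjective
  \<open>\<sigma>\<^sub>t\<close> under Markov feasibility.\<close>

definition pa_feasible ::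
    "'s env \<Rightarrow> (nat \<Rightarrow> 's hist \<Rightarrow> 'x) \<Rightarrow> (nat \<Rightarrow> 's hist \<Rightarrow> real set) \<Rightarrow> nat \<Rightarrow> 'x \<Rightarrow> real set" where
  "pa_feasible E \<sigma> A t x = A t (inv_into (hist_set E t) (\<sigma> t) x)"

lemma pa_feasible_summary:
  assumes "Markov_feasible E \<sigma> A" "t \<le> horizon E" "h \<in> hist_set E t"
  shows "pa_feasible E \<sigma> A t (\<sigma> t h) = A t h"
proof -
  have "\<sigma> t h \<in> \<sigma> t ` hist_set E t"
    using assms by blast
  then show ?thesis
    using assms unfolding Markov_feasible_def pa_feasible_def
    by (meson f_inv_into_f inv_into_into)
qed

definition upper_hemicontinuous_map :: "'a topology \<Rightarrow> 'b topology \<Rightarrow> ('a \<Rightarrow> 'b set) \<Rightarrow> bool" where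
  "upper_hemicontinuous_map X Y F \<longleftrightarrow>
     (\<forall>G. openin Y G \<longrightarrow> openin X {x \<in> topspace X. F x \<subseteq> G})"

definition lower_hemicontinuous_map :: "'a topology \<Rightarrow> 'b topology \<Rightarrow> ('a \<Rightarrow> 'b set) \<Rightarrow> bool" where
  "lower_hemicontinuous_map X Y F \<longleftrightarrow>
     (\<forall>G. openin Y G \<longrightarrow> openin X {x \<in> topspace X. F x \<inter> G \<noteq> {}})"

definition DP_regular ::
    "'s env \<Rightarrow> ('s, 'x) pa_sys \<Rightarrow> (nat \<Rightarrow> 's hist \<Rightarrow> 'x) \<Rightarrow> (nat \<Rightarrow> 's hist \<Rightarrow> real set) \<Rightarrow> bool"
  where
  "DP_regular E X \<sigma> A \<longleftrightarrow>
     (\<forall>t\<le>horizon E.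
        upper_hemicontinuous_map (pa_space X t) (cons_top E) (pa_feasible E \<sigma> A t) \<and>
        lower_hemicontinuous_map (pa_space X t) (cons_top E) (pa_feasible E \<sigma> A t) \<and>
        (\<forall>x\<in>topspace (pa_space X t).
           pa_feasible E \<sigma> A t x \<noteq> {} \<and> compactin (cons_top E) (pa_feasible E \<sigma> A t x)))"

definition Markov_policies ::
    "'s env \<Rightarrow> ('s, 'x) pa_sys \<Rightarrow> (nat \<Rightarrow> 's hist \<Rightarrow> 'x) \<Rightarrow> (nat \<Rightarrow> 's hist \<Rightarrow> real set) \<Rightarrow>
     (nat \<Rightarrow> 'x \<Rightarrow> real) set" where
  "Markov_policies E X \<sigma> A =
     {\<pi>. \<forall>t\<le>horizon E. \<forall>x\<in>topspace (pa_space X t). \<pi> t x \<in> pa_feasible E \<sigma> A t x}"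

function Markov_policy_util ::
    "'s env \<Rightarrow> ('s, 'x) pa_sys \<Rightarrow> ('s, 'x) pa_rec \<Rightarrow> (nat \<Rightarrow> 'x \<Rightarrow> real) \<Rightarrow> nat \<Rightarrow> 'x \<Rightarrow> real" where
  "Markov_policy_util E X V \<pi> t x =
     (if t < horizon E
      then aggr V t x (\<pi> t x)
             (cert V t x
               (\<lambda>s\<in>states E. Markov_policy_util E X V \<pi> (Suc t) (pa_trans X t x (\<pi> t x) s)))
      else if t = horizon E
      then Markov_policy_util E X V \<pi> (Suc t) (pa_trans X t x (\<pi> t x) (term_state E))
      else end_val V x)"
  by pat_completeness auto
termination by (relation "Wellfounded.measure (\<lambda>(E, X, V, \<pi>, t, x). Suc (horizon E) - t)") auto

declare Markov_policy_util.simps [simp del]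

definition value_fun ::
    "'s env \<Rightarrow> ('s, 'x) pa_sys \<Rightarrow> ('s, 'x) pa_rec \<Rightarrow> (nat \<Rightarrow> 's hist \<Rightarrow> 'x) \<Rightarrow>
     (nat \<Rightarrow> 's hist \<Rightarrow> real set) \<Rightarrow> nat \<Rightarrow> 'x \<Rightarrow> real" where
  "value_fun E X V \<sigma> A t x = (SUP \<pi>\<in>Markov_policies E X \<sigma> A. Markov_policy_util E X V \<pi> t x)"

definition Bellman_selector ::
    "'s env \<Rightarrow> ('s, 'x) pa_sys \<Rightarrow> ('s, 'x) pa_rec \<Rightarrow> (nat \<Rightarrow> 's hist \<Rightarrow> 'x) \<Rightarrow>
     (nat \<Rightarrow> 's hist \<Rightarrow> real set) \<Rightarrow> (nat \<Rightarrow> 'x \<Rightarrow> real) \<Rightarrow> bool" where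
  "Bellman_selector E X V \<sigma> A \<pi> \<longleftrightarrow>
     \<pi> \<in> Markov_policies E X \<sigma> A \<and>
     (\<forall>x\<in>topspace (pa_space X (horizon E)).
        is_arg_max (\<lambda>c. end_val V (pa_trans X (horizon E) x c (term_state E)))
          (\<lambda>c. c \<in> pa_feasible E \<sigma> A (horizon E) x) (\<pi> (horizon E) x)) \<and>
     (\<forall>t<horizon E. \<forall>x\<in>topspace (pa_space X t).
        is_arg_max
          (\<lambda>c. aggr V t x c
                 (cert V t x (\<lambda>s\<in>states E. value_fun E X V \<sigma> A (t + 1) (pa_trans X t x c s))))
          (\<lambda>c. c \<in> pa_feasible E \<sigma> A t x) (\<pi> t x))"

end

theory Submission
  imports Defs
begin

text \<open>All utilities obey the same backward recursion, whose step is monotone in the continuation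
  utilities. On PA states, backward induction shows that a Bellman selector dominates all Markov
  policies and hence attains \<open>J\<^sup>*\<close>, so that \<open>J\<^sup>*\<close> bounds the stage utility of every feasible
  choice followed by \<open>J\<^sup>*\<close> itself. A second backward induction, on histories, propagates this
  inequality to arbitrary policies: the summary maps turn the continuation histories into the PA
  states at which it is available.\<close>

section \<open>Stage utilities\<close>

text \<open>The continuation utilities form a family over \<open>S\<^sub>t\<^sub>+\<^sub>1\<close>. As \<open>S\<^sub>T\<^sub>+\<^sub>1 = {\<star>}\<close>, there is nothing to
  aggregate at \<open>T\<close>, and the terminal equations of all recursions become instances of the general
  ones.\<close>

definition stage_util ::
    "'s env \<Rightarrow> ('s, 'x) pa_rec \<Rightarrow> nat \<Rightarrow> 'x \<Rightarrow> real \<Rightarrow> ('s \<Rightarrow> real) \<Rightarrow> real" where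
  "stage_util E V t x c u =
     (if t < horizon E then aggr V t x c (cert V t x (restrict u (states E)))
      else u (term_state E))"

lemma state_set_Suc:
  "state_set E (Suc t) = (if t < horizon E then states E else {term_state E})"
  by (simp add: state_set_def)

lemma stage_util_cong:
  assumes "\<And>s. s \<in> state_set E (Suc t) \<Longrightarrow> u s = w s"
  shows "stage_util E V t x c u = stage_util E V t x c w"
  using assms by (auto simp: stage_util_def state_set_Suc cong: restrict_cong)

lemma stage_util_mono:
  assumes V: "pa_recursive_structure E X V"
    and x: "x \<in> topspace (pa_space X t)" and c: "c \<in> cons_set E"
    and le: "\<And>s. s \<in> state_set E (Suc t) \<Longrightarrow> u s \<le> w s"
  shows "stage_util E V t x c u \<le> stage_util E V t x c w"
proof (cases "t < horizon E")
  case True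
  have "restrict u (states E) \<in> vec_set E" "restrict w (states E) \<in> vec_set E"
    by (simp_all add: vec_set_def)
  moreover have "\<forall>s\<in>states E. restrict u (states E) s \<le> restrict w (states E) s"
    using le True by (simp add: state_set_Suc)
  ultimately have "cert V t x (restrict u (states E)) \<le> cert V t x (restrict w (states E))"
    using V x True unfolding pa_recursive_structure_def by blast
  moreover have "mono (aggr V t x c)"
    using V x c True by (simp add: pa_recursive_structure_def)
  ultimately show ?thesis
    using True by (simp add: stage_util_def monoD)
next
  case False
  then show ?thesis
    using le by (simp add: stage_util_def state_set_Suc)
qed

lemma Markov_policy_util_end: "Markov_policy_util E X V \<pi> (Suc (horizon E)) x = end_val V x"
  by (simp add: Markov_policy_util.simps)

lemma Markov_policy_util_stage:
  assumes "t \<le> horizon E"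
  shows "Markov_policy_util E X V \<pi> t x =
    stage_util E V t x (\<pi> t x)
      (\<lambda>s. Markov_policy_util E X V \<pi> (Suc t) (pa_trans X t x (\<pi> t x) s))"
  using assms by (simp add: Markov_policy_util.simps [of E X V \<pi> t] stage_util_def)

section \<open>Bellman selectors attain the value function\<close>

lemma pa_trans_in_topspace:
  assumes "pa_state_system E X" "t \<le> horizon E" "x \<in> topspace (pa_space X t)"
    and "c \<in> cons_set E" "s \<in> state_set E (Suc t)"
  shows "pa_trans X t x c s \<in> topspace (pa_space X (Suc t))"
proof -
  have "continuous_map
      (prod_topology (pa_space X t)
        (prod_topology (cons_top E) (discrete_topology (state_set E (Suc t)))))
      (pa_space X (Suc t)) (\<lambda>(x, c, s). pa_trans X t x c s)"
    using assms(1,2) by (simp add: pa_state_system_def)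
  from continuous_map_funspace [OF this] show ?thesis
    using assms(3-5) by (auto simp: Pi_iff)
qed

lemma pa_feasible_in_cons_set:
  assumes "DP_regular E X \<sigma> A" "t \<le> horizon E" "x \<in> topspace (pa_space X t)"
    and "c \<in> pa_feasible E \<sigma> A t x"
  shows "c \<in> cons_set E"
  using assms compactin_subset_topspace by (fastforce simp: DP_regular_def)

lemma Markov_policy_feasible:
  assumes "\<pi> \<in> Markov_policies E X \<sigma> A" "t \<le> horizon E" "x \<in> topspace (pa_space X t)"
  shows "\<pi> t x \<in> pa_feasible E \<sigma> A t x"
  using assms by (simp add: Markov_policies_def)

lemma value_fun_eq_maximum:
  assumes "\<pi> \<in> Markov_policies E X \<sigma> A"
    and "\<And>\<rho>. \<rho> \<in> Markov_policies E X \<sigma> A \<Longrightarrow>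
      Markov_policy_util E X V \<rho> t x \<le> Markov_policy_util E X V \<pi> t x"
  shows "value_fun E X V \<sigma> A t x = Markov_policy_util E X V \<pi> t x"
  unfolding value_fun_def using assms by (intro cSup_eq_maximum) auto

lemma Bellman_selector_in_Markov_policies:
  assumes "Bellman_selector E X V \<sigma> A \<pi>"
  shows "\<pi> \<in> Markov_policies E X \<sigma> A"
  using assms by (simp add: Bellman_selector_def)

lemma Bellman_selector_maximizes_stage_util:
  assumes sel: "Bellman_selector E X V \<sigma> A \<pi>" and t: "t \<le> horizon E"
    and x: "x \<in> topspace (pa_space X t)" and c: "c \<in> pa_feasible E \<sigma> A t x"
  shows "stage_util E V t x c (\<lambda>s. value_fun E X V \<sigma> A (Suc t) (pa_trans X t x c s))
    \<le> stage_util E V t x (\<pi> t x)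
        (\<lambda>s. value_fun E X V \<sigma> A (Suc t) (pa_trans X t x (\<pi> t x) s))"
proof (cases "t < horizon E")
  case True
  then show ?thesis
    using sel x c by (simp add: Bellman_selector_def is_arg_max_linorder stage_util_def)
next
  case False
  have "value_fun E X V \<sigma> A (Suc (horizon E)) y = end_val V y" for y
    using value_fun_eq_maximum [OF Bellman_selector_in_Markov_policies [OF sel]]
    by (simp add: Markov_policy_util_end)
  moreover have "t = horizon E"
    using False t by simp
  ultimately show ?thesis
    using sel x c by (simp add: Bellman_selector_def is_arg_max_linorder stage_util_def)
qed

locale pa_decision_problem =
  fixes E :: "'s env"
    and X :: "('s, 'x) pa_sys"
    and V :: "('s, 'x) pa_rec"
    and \<sigma> :: "nat \<Rightarrow> 's hist \<Rightarrow> 'x"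
    and A :: "nat \<Rightarrow> 's hist \<Rightarrow> real set"
    and \<pi>bar :: "nat \<Rightarrow> 'x \<Rightarrow> real"
  assumes state_system: "pa_state_system E X"
    and recursive_structure: "pa_recursive_structure E X V"
    and regular: "DP_regular E X \<sigma> A"
    and selector: "Bellman_selector E X V \<sigma> A \<pi>bar"
begin

abbreviation J :: "nat \<Rightarrow> 'x \<Rightarrow> real" where
  "J \<equiv> value_fun E X V \<sigma> A"

abbreviation policy_util :: "(nat \<Rightarrow> 'x \<Rightarrow> real) \<Rightarrow> nat \<Rightarrow> 'x \<Rightarrow> real" where
  "policy_util \<equiv> Markov_policy_util E X V"

lemmas selector_policy = Bellman_selector_in_Markov_policies [OF selector]

lemmas feasible_in_cons_set = pa_feasible_in_cons_set [OF regular]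

lemma stage_util_le_selector_util:
  assumes t: "t \<le> horizon E" and x: "x \<in> topspace (pa_space X t)"
    and c: "c \<in> pa_feasible E \<sigma> A t x"
    and attained: "\<And>y. y \<in> topspace (pa_space X (Suc t)) \<Longrightarrow>
      J (Suc t) y = policy_util \<pi>bar (Suc t) y"
  shows "stage_util E V t x c (\<lambda>s. J (Suc t) (pa_trans X t x c s)) \<le> policy_util \<pi>bar t x"
proof -
  have "\<pi>bar t x \<in> cons_set E"
    by (rule feasible_in_cons_set [OF t x Markov_policy_feasible [OF selector_policy t x]])
  note trans = pa_trans_in_topspace [OF state_system t x this]
  have "stage_util E V t x c (\<lambda>s. J (Suc t) (pa_trans X t x c s))
      \<le> stage_util E V t x (\<pi>bar t x) (\<lambda>s. J (Suc t) (pa_trans X t x (\<pi>bar t x) s))"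
    by (rule Bellman_selector_maximizes_stage_util [OF selector t x c])
  also have "\<dots> = stage_util E V t x (\<pi>bar t x)
      (\<lambda>s. policy_util \<pi>bar (Suc t) (pa_trans X t x (\<pi>bar t x) s))"
    by (rule stage_util_cong) (rule attained [OF trans])
  also have "\<dots> = policy_util \<pi>bar t x"
    by (rule Markov_policy_util_stage [OF t, symmetric])
  finally show ?thesis .
qed

lemma policy_util_le_selector_util:
  assumes \<rho>: "\<rho> \<in> Markov_policies E X \<sigma> A"
    and "t \<le> Suc (horizon E)" "x \<in> topspace (pa_space X t)"
  shows "policy_util \<rho> t x \<le> policy_util \<pi>bar t x"
  using assms(2,3) \<rho>
proof (induction t arbitrary: x \<rho> rule: inc_induct)
  case base
  then show ?case
    by (simp add: Markov_policy_util_end)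
next
  case (step t)
  have t: "t \<le> horizon E"
    using step.hyps by simp
  note x = step.prems(1)
  note feasible = Markov_policy_feasible [OF step.prems(2) t x]
  note choice = feasible_in_cons_set [OF t x feasible]
  have attained: "J (Suc t) y = policy_util \<pi>bar (Suc t) y"
    if "y \<in> topspace (pa_space X (Suc t))" for y
    by (rule value_fun_eq_maximum [OF selector_policy step.IH [OF that]])
  have "policy_util \<rho> t x
      = stage_util E V t x (\<rho> t x) (\<lambda>s. policy_util \<rho> (Suc t) (pa_trans X t x (\<rho> t x) s))"
    by (rule Markov_policy_util_stage [OF t])
  also have "\<dots> \<le> stage_util E V t x (\<rho> t x) (\<lambda>s. J (Suc t) (pa_trans X t x (\<rho> t x) s))"
  proof (rule stage_util_mono [OF recursive_structure x choice])
    fix s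
    assume "s \<in> state_set E (Suc t)"
    then have "pa_trans X t x (\<rho> t x) s \<in> topspace (pa_space X (Suc t))"
      by (rule pa_trans_in_topspace [OF state_system t x choice])
    then show "policy_util \<rho> (Suc t) (pa_trans X t x (\<rho> t x) s)
        \<le> J (Suc t) (pa_trans X t x (\<rho> t x) s)"
      using step.IH step.prems(2) attained by simp
  qed
  also have "\<dots> \<le> policy_util \<pi>bar t x"
    by (rule stage_util_le_selector_util [OF t x feasible attained])
  finally show ?case .
qed

lemma value_fun_eq_selector_util:
  assumes "t \<le> Suc (horizon E)" "x \<in> topspace (pa_space X t)"
  shows "J t x = policy_util \<pi>bar t x"
  by (rule value_fun_eq_maximum [OF selector_policy policy_util_le_selector_util [OF _ assms]])

lemma stage_util_le_value_fun:
  assumes "t \<le> horizon E" "x \<in> topspace (pa_space X t)" "c \<in> pa_feasible E \<sigma> A t x"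
  shows "stage_util E V t x c (\<lambda>s. J (Suc t) (pa_trans X t x c s)) \<le> J t x"
  using stage_util_le_selector_util [OF assms] value_fun_eq_selector_util assms by simp

end

section \<open>Utilities of history-dependent policies\<close>

lemma hist_extend_in_hist_set:
  assumes "t \<le> horizon E" "h \<in> hist_set E t" "c \<in> cons_set E" "s \<in> state_set E (Suc t)"
  shows "hist_extend E t h c s \<in> hist_set E (Suc t)"
  using assms by (auto simp: hist_extend_def)

abbreviation consumption_policies :: "'s env \<Rightarrow> (nat \<Rightarrow> 's hist \<Rightarrow> real) set" where
  "consumption_policies E \<equiv> history_policies E (\<lambda>_ _. cons_set E)"

lemma consumption_policyD:
  assumes "\<phi> \<in> consumption_policies E" "t \<le> horizon E" "h \<in> hist_set E t"
  shows "\<phi> t h \<in> cons_set E"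
  using assms by (simp add: history_policies_def)

lemma induced_plan_in_plan_set:
  assumes "\<phi> \<in> consumption_policies E" "t \<le> horizon E" "h \<in> hist_set E t"
  shows "induced_plan E \<phi> t h \<in> plan_set E t"
  using assms(2,3)
proof (induction t arbitrary: h rule: inc_induct)
  case base
  then show ?case
    using consumption_policyD [OF assms(1)] by (simp add: induced_plan.simps plan_set_horizon)
next
  case (step t)
  have t: "t \<le> horizon E"
    using step.hyps by simp
  have choice: "\<phi> t h \<in> cons_set E"
    by (rule consumption_policyD [OF assms(1) t step.prems])
  have "induced_plan E \<phi> (Suc t) (hist_extend E t h (\<phi> t h) s) \<in> plan_set E (Suc t)"
    if "s \<in> states E" for s
    using step.IH hist_extend_in_hist_set [OF t step.prems choice] step.hyps that
    by (simp add: state_set_Suc)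
  then show ?case
    using step.hyps choice by (simp add: induced_plan.simps [of E \<phi> t] plan_set.simps [of E t])
qed

definition realized_util ::
    "'s env \<Rightarrow> 's util_sys \<Rightarrow> (nat \<Rightarrow> 's hist \<Rightarrow> real) \<Rightarrow> nat \<Rightarrow> 's hist \<Rightarrow> real" where
  "realized_util E U \<phi> t h =
     (if t \<le> horizon E then history_policy_util E U \<phi> t h else util_end U h)"

locale factorized_utility =
  fixes E :: "'s env"
    and X :: "('s, 'x) pa_sys"
    and V :: "('s, 'x) pa_rec"
    and \<sigma> :: "nat \<Rightarrow> 's hist \<Rightarrow> 'x"
    and U :: "'s util_sys"
  assumes factorizes: "factorizes E X V \<sigma> U"
begin

lemma summary_in_topspace:
  assumes "t \<le> Suc (horizon E)" "h \<in> hist_set E t"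
  shows "\<sigma> t h \<in> topspace (pa_space X t)"
  using factorizes assms continuous_map_funspace [of "hist_top E t" "pa_space X t" "\<sigma> t"]
  by (auto simp: factorizes_def topspace_hist_top)

lemma summary_hist_extend:
  assumes "t \<le> horizon E" "h \<in> hist_set E t" "c \<in> cons_set E" "s \<in> state_set E (Suc t)"
  shows "\<sigma> (Suc t) (hist_extend E t h c s) = pa_trans X t (\<sigma> t h) c s"
  using factorizes assms by (simp add: factorizes_def)

lemma realized_util_end:
  assumes "h \<in> hist_set E (Suc (horizon E))"
  shows "realized_util E U \<phi> (Suc (horizon E)) h = end_val V (\<sigma> (Suc (horizon E)) h)"
  using factorizes assms by (simp add: factorizes_def realized_util_def del: hist_set.simps)

lemma realized_util_eq_pa_util:
  assumes "\<phi> \<in> consumption_policies E" "t \<le> horizon E" "h \<in> hist_set E t"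
  shows "realized_util E U \<phi> t h = pa_util E X V t (\<sigma> t h) (induced_plan E \<phi> t h)"
  using factorizes assms induced_plan_in_plan_set [OF assms]
  by (simp add: factorizes_def realized_util_def history_policy_util_def)

lemma realized_util_stage:
  assumes \<phi>: "\<phi> \<in> consumption_policies E" and t: "t \<le> horizon E" and h: "h \<in> hist_set E t"
  shows "realized_util E U \<phi> t h =
    stage_util E V t (\<sigma> t h) (\<phi> t h)
      (\<lambda>s. realized_util E U \<phi> (Suc t) (hist_extend E t h (\<phi> t h) s))"
proof -
  let ?next = "hist_extend E t h (\<phi> t h)"
  have choice: "\<phi> t h \<in> cons_set E"
    by (rule consumption_policyD [OF assms])
  note extend = hist_extend_in_hist_set [OF t h choice]
  note summary = summary_hist_extend [OF t h choice]
  show ?thesis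
  proof (cases "t < horizon E")
    case True
    have "realized_util E U \<phi> t h = stage_util E V t (\<sigma> t h) (\<phi> t h)
        (\<lambda>s. pa_util E X V (Suc t) (pa_trans X t (\<sigma> t h) (\<phi> t h) s)
          (induced_plan E \<phi> (Suc t) (?next s)))"
      using realized_util_eq_pa_util [OF assms] True
      by (simp add: pa_util.simps [of E X V t] induced_plan.simps [of E \<phi> t] stage_util_def
          cong: restrict_cong)
    also have "\<dots> = stage_util E V t (\<sigma> t h) (\<phi> t h) (\<lambda>s. realized_util E U \<phi> (Suc t) (?next s))"
      using realized_util_eq_pa_util [OF \<phi>] extend summary True by (intro stage_util_cong) simp
    finally show ?thesis .
  next
    case False
    then have at_horizon: "t = horizon E"
      using t by simp
    have "term_state E \<in> state_set E (Suc t)"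
      using at_horizon by (simp add: state_set_Suc)
    then have "realized_util E U \<phi> (Suc t) (?next (term_state E))
        = end_val V (pa_trans X t (\<sigma> t h) (\<phi> t h) (term_state E))"
      using realized_util_end extend summary at_horizon by simp
    also have "\<dots> = realized_util E U \<phi> t h"
      using realized_util_eq_pa_util [OF assms] at_horizon
      by (simp add: pa_util.simps induced_plan.simps last_plan_def)
    finally show ?thesis
      using at_horizon by (simp add: stage_util_def)
  qed
qed

lemma realized_util_Markov:
  assumes \<phi>: "\<phi> \<in> consumption_policies E"
    and Markov: "\<forall>t\<le>horizon E. \<forall>h\<in>hist_set E t. \<phi> t h = \<pi> t (\<sigma> t h)"
    and "t \<le> Suc (horizon E)" "h \<in> hist_set E t"
  shows "realized_util E U \<phi> t h = Markov_policy_util E X V \<pi> t (\<sigma> t h)"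
  using assms(3,4)
proof (induction t arbitrary: h rule: inc_induct)
  case base
  then show ?case
    by (simp add: realized_util_end Markov_policy_util_end del: hist_set.simps)
next
  case (step t)
  have t: "t \<le> horizon E"
    using step.hyps by simp
  note choice = consumption_policyD [OF \<phi> t step.prems]
  have "realized_util E U \<phi> t h = stage_util E V t (\<sigma> t h) (\<phi> t h)
      (\<lambda>s. realized_util E U \<phi> (Suc t) (hist_extend E t h (\<phi> t h) s))"
    by (rule realized_util_stage [OF \<phi> t step.prems])
  also have "\<dots> = stage_util E V t (\<sigma> t h) (\<phi> t h)
      (\<lambda>s. Markov_policy_util E X V \<pi> (Suc t) (pa_trans X t (\<sigma> t h) (\<phi> t h) s))"
    using step.IH hist_extend_in_hist_set [OF t step.prems choice]
      summary_hist_extend [OF t step.prems choice]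
    by (intro stage_util_cong) simp
  also have "\<dots> = Markov_policy_util E X V \<pi> t (\<sigma> t h)"
    using Markov t step.prems by (simp add: Markov_policy_util_stage [OF t, of X V \<pi>])
  finally show ?case .
qed

end

section \<open>Domination by the value function\<close>

locale factorized_decision_problem =
  pa_decision_problem E X V \<sigma> A \<pi>bar + factorized_utility E X V \<sigma> U
  for E :: "'s env"
    and X :: "('s, 'x) pa_sys"
    and V :: "('s, 'x) pa_rec"
    and \<sigma> :: "nat \<Rightarrow> 's hist \<Rightarrow> 'x"
    and A :: "nat \<Rightarrow> 's hist \<Rightarrow> real set"
    and \<pi>bar :: "nat \<Rightarrow> 'x \<Rightarrow> real"
    and U :: "'s util_sys" +
  assumes Markov_feasible: "Markov_feasible E \<sigma> A"
begin

lemma history_policy_feasible: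
  assumes "\<phi> \<in> history_policies E A" "t \<le> horizon E" "h \<in> hist_set E t"
  shows "\<phi> t h \<in> pa_feasible E \<sigma> A t (\<sigma> t h)"
  using assms pa_feasible_summary [OF Markov_feasible] by (simp add: history_policies_def)

lemma feasible_at_summary_in_cons_set:
  assumes "t \<le> horizon E" "h \<in> hist_set E t" "c \<in> pa_feasible E \<sigma> A t (\<sigma> t h)"
  shows "c \<in> cons_set E"
proof (rule feasible_in_cons_set [OF assms(1) _ assms(3)])
  show "\<sigma> t h \<in> topspace (pa_space X t)"
    using summary_in_topspace assms(1,2) by simp
qed

lemma realized_util_le_value_fun:
  assumes \<phi>: "\<phi> \<in> history_policies E A" and "t \<le> Suc (horizon E)" "h \<in> hist_set E t"
  shows "realized_util E U \<phi> t h \<le> J t (\<sigma> t h)"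
  using assms(2,3)
proof (induction t arbitrary: h rule: inc_induct)
  case base
  then show ?case
    using value_fun_eq_selector_util summary_in_topspace
    by (simp add: realized_util_end Markov_policy_util_end del: hist_set.simps)
next
  case (step t)
  have t: "t \<le> horizon E"
    using step.hyps by simp
  note feasible = history_policy_feasible [OF \<phi> t step.prems]
  note choice = feasible_at_summary_in_cons_set [OF t step.prems feasible]
  have x: "\<sigma> t h \<in> topspace (pa_space X t)"
    using summary_in_topspace t step.prems by simp
  have "\<phi> \<in> consumption_policies E"
    using history_policy_feasible [OF \<phi>] feasible_at_summary_in_cons_set
    by (simp add: history_policies_def)
  then have "realized_util E U \<phi> t h = stage_util E V t (\<sigma> t h) (\<phi> t h)
      (\<lambda>s. realized_util E U \<phi> (Suc t) (hist_extend E t h (\<phi> t h) s))"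
    by (rule realized_util_stage [OF _ t step.prems])
  also have "\<dots> \<le> stage_util E V t (\<sigma> t h) (\<phi> t h)
      (\<lambda>s. J (Suc t) (pa_trans X t (\<sigma> t h) (\<phi> t h) s))"
  proof (rule stage_util_mono [OF recursive_structure x choice])
    fix s
    assume s: "s \<in> state_set E (Suc t)"
    show "realized_util E U \<phi> (Suc t) (hist_extend E t h (\<phi> t h) s)
        \<le> J (Suc t) (pa_trans X t (\<sigma> t h) (\<phi> t h) s)"
      using step.IH [OF hist_extend_in_hist_set [OF t step.prems choice s]]
        summary_hist_extend [OF t step.prems choice s] by simp
  qed
  also have "\<dots> \<le> J t (\<sigma> t h)"
    by (rule stage_util_le_value_fun [OF t x feasible])
  finally show ?case .
qed

lemma value_fun_eq_realized_util:
  assumes \<phi>bar: "\<forall>t\<le>horizon E. \<forall>h\<in>hist_set E t. \<phi>bar t h = \<pi>bar t (\<sigma> t h)"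
    and t: "t \<le> Suc (horizon E)" and h: "h \<in> hist_set E t"
  shows "J t (\<sigma> t h) = realized_util E U \<phi>bar t h"
proof -
  have "\<phi>bar \<in> consumption_policies E"
    using \<phi>bar Markov_policy_feasible [OF selector_policy] summary_in_topspace
      feasible_at_summary_in_cons_set
    by (simp add: history_policies_def)
  then show ?thesis
    using realized_util_Markov [OF _ \<phi>bar t h]
      value_fun_eq_selector_util [OF t summary_in_topspace [OF t h]] by simp
qed

end

theorem theorem5p5:
  fixes E :: "'s env"
    and P :: "'s grand_pref"
    and U :: "'s util_sys"
    and X :: "('s, 'x) pa_sys"
    and V :: "('s, 'x) pa_rec"
    and \<sigma> :: "nat \<Rightarrow> 's hist \<Rightarrow> 'x"
    and A :: "nat \<Rightarrow> 's hist \<Rightarrow> real set"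
    and \<pi>bar :: "nat \<Rightarrow> 'x \<Rightarrow> real"
    and \<phi>bar :: "nat \<Rightarrow> 's hist \<Rightarrow> real"
  assumes "primitives E"
    and "grand_preference E P"
    and "utility_system E U"
    and "compatible E P U"
    and "pa_state_system E X"
    and "pa_recursive_structure E X V"
    and "factorizes E X V \<sigma> U"
    and "\<forall>t\<le>horizon E + 1. \<sigma> t ` hist_set E t = topspace (pa_space X t)"
    and "feasibility_correspondence E A"
    and "Markov_feasible E \<sigma> A"
    and "DP_regular E X \<sigma> A"
    and "Bellman_selector E X V \<sigma> A \<pi>bar"
    and "\<forall>t\<le>horizon E. \<forall>h\<in>hist_set E t. \<phi>bar t h = \<pi>bar t (\<sigma> t h)"
  shows "\<forall>\<phi>\<in>history_policies E A. \<forall>t\<le>horizon E. \<forall>h\<in>hist_set E t.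
           history_policy_util E U \<phi> t h \<le> value_fun E X V \<sigma> A t (\<sigma> t h) \<and>
           value_fun E X V \<sigma> A t (\<sigma> t h) = history_policy_util E U \<phi>bar t h"
proof (intro ballI allI impI conjI)
  interpret factorized_decision_problem E X V \<sigma> A \<pi>bar U
    using assms(5-7,10-12) by unfold_locales
  fix \<phi> t h
  assume \<phi>: "\<phi> \<in> history_policies E A" and t: "t \<le> horizon E" and h: "h \<in> hist_set E t"
  show "history_policy_util E U \<phi> t h \<le> value_fun E X V \<sigma> A t (\<sigma> t h)"
    using realized_util_le_value_fun [OF \<phi> _ h] t by (simp add: realized_util_def)
  show "value_fun E X V \<sigma> A t (\<sigma> t h) = history_policy_util E U \<phi>bar t h"
    using value_fun_eq_realized_util [OF assms(13) _ h] t by (simp add: realized_util_def)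
qed

end
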